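(* Let $K$ be a topological field and let $V$ and $W$ be pro-f.-d. spaces over $K$. If $T:V\to W$ is a continuous $K$-linear transformation, then its image $T(V)$ is a closed subspace of $W$.
   Context: A topological field is a field with a Hausdorff topology for which the field operations are continuous (the discrete topology is allowed). A pro-f.-d. space over $K$ is a topological $K$-vector space $V$ which is the inverse limit of an inverse sequence $$\cdots \xrightarrow{q_m} V_m \xrightarrow{q_{m-1}} \cdots \xrightarrow{q_1} V_1$$ in which every $V_i$ is a finite-dimensional $K$-vector space (with the Hausdorff topology given by a linear identification with $K^{\dim V_i}$, product topology), every $q_i:V_{i+1}\to V_i$ is $K$-linear, and the inverse limit is given the inverse limit topology. Concretely, $V$ is the set of sequences $(v_i)_i\in\prod_i V_i$ with $q_i(v_{i+1})=v_i$ for every $i\geq 1$, with pointwise operations and the topology restricted from the product topology on $\prod_i V_i$. *)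

theory Defs
  imports "HOL-Analysis.Analysis"
begin

text \<open>The last axiom is continuity of inversion on the complement of \<open>0\<close>, which is open since
  the topology is Hausdorff.\<close>

class topological_field = field + topological_ab_group_add + topological_semigroup_mult + t2_space +
  assumes tendsto_inverse_nhds: "a \<noteq> 0 \<Longrightarrow> (inverse \<longlongrightarrow> inverse a) (nhds a)"

text \<open>Topological vector spaces are represented by a topology whose \<open>topspace\<close> is a subspace of
  an ambient vector space given by its scalar multiplication \<open>s\<close>. The case of a whole type is
  \<open>topspace X = UNIV\<close>.\<close>

definition linear_on ::
    "('k \<Rightarrow> 'a::ab_group_add \<Rightarrow> 'a) \<Rightarrow> ('k \<Rightarrow> 'b::ab_group_add \<Rightarrow> 'b) \<Rightarrow> 'a set \<Rightarrow> ('a \<Rightarrow> 'b) \<Rightarrow> bool" where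
  "linear_on s1 s2 S f \<longleftrightarrow>
     (\<forall>x\<in>S. \<forall>y\<in>S. f (x + y) = f x + f y) \<and> (\<forall>c. \<forall>x\<in>S. f (s1 c x) = s2 c (f x))"

definition topological_vector_space ::
    "('k::topological_field \<Rightarrow> 'a::ab_group_add \<Rightarrow> 'a) \<Rightarrow> 'a topology \<Rightarrow> bool" where
  "topological_vector_space s X \<longleftrightarrow>
     vector_space s \<and> module.subspace s (topspace X) \<and>
     continuous_map (prod_topology X X) X (\<lambda>(x, y). x + y) \<and>
     continuous_map (prod_topology euclidean X) X (\<lambda>(c, x). s c x)"

text \<open>\<open>K\<^sup>n\<close> with its product topology is \<open>product_topology (\<lambda>_. euclidean) {..<n}\<close>. Its points
  are extensional functions, so linearity of the identification \<open>\<phi>\<close> is required of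
  each of its \<open>n\<close> coordinates.\<close>

definition fd_space ::
    "('k::topological_field \<Rightarrow> 'a::ab_group_add \<Rightarrow> 'a) \<Rightarrow> 'a topology \<Rightarrow> bool" where
  "fd_space s X \<longleftrightarrow>
     vector_space s \<and>
     (\<exists>B. finite B \<and> module.span s B = topspace X) \<and>
     (\<exists>\<phi>. (\<forall>i < vector_space.dim s (topspace X). linear_on s (*) (topspace X) (\<lambda>x. \<phi> x i)) \<and>
          homeomorphic_map X
            (product_topology (\<lambda>_. euclidean :: 'k topology) {..<vector_space.dim s (topspace X)}) \<phi>)"

text \<open>The stage with index \<open>i\<close> is \<open>topspace (F i)\<close>, indices starting at \<open>0\<close>. All stages live in
  one ambient vector space. This loses no generality: any sequence of vector spaces embeds in
  its direct sum.\<close>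

definition fd_inverse_sequence ::
    "('k::topological_field \<Rightarrow> 'a::ab_group_add \<Rightarrow> 'a) \<Rightarrow> (nat \<Rightarrow> 'a topology) \<Rightarrow> (nat \<Rightarrow> 'a \<Rightarrow> 'a) \<Rightarrow> bool" where
  "fd_inverse_sequence s F q \<longleftrightarrow>
     (\<forall>i. fd_space s (F i)) \<and>
     (\<forall>i. q i \<in> topspace (F (Suc i)) \<rightarrow> topspace (F i)) \<and>
     (\<forall>i. linear_on s s (topspace (F (Suc i))) (q i))"

definition inverse_limit :: "(nat \<Rightarrow> 'a topology) \<Rightarrow> (nat \<Rightarrow> 'a \<Rightarrow> 'a) \<Rightarrow> (nat \<Rightarrow> 'a) topology" where
  "inverse_limit F q =
     subtopology (product_topology F UNIV)
       {v. (\<forall>i. v i \<in> topspace (F i)) \<and> (\<forall>i. q i (v (Suc i)) = v i)}"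

text \<open>\<open>X\<close>, with scalar multiplication \<open>s\<close>, is the limit of some inverse sequence of
  finite-dimensional subspaces of the vector space with scalar multiplication \<open>sA\<close>. Being the
  limit means being identified with the space of compatible sequences by a linear homeomorphism
  \<open>h\<close>, whose coordinate \<open>\<lambda>x. h x i\<close> is the projection to stage \<open>i\<close>.\<close>

definition pro_fd_space ::
    "('k::topological_field \<Rightarrow> 'a::ab_group_add \<Rightarrow> 'a) \<Rightarrow> ('k \<Rightarrow> 'v::ab_group_add \<Rightarrow> 'v) \<Rightarrow> 'v topology \<Rightarrow> bool" where
  "pro_fd_space sA s X \<longleftrightarrow>
     topological_vector_space s X \<and>
     (\<exists>F q h. fd_inverse_sequence sA F q \<and>
        (\<forall>i. linear_on s sA (topspace X) (\<lambda>x. h x i)) \<and>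
        homeomorphic_map X (inverse_limit F q) h)"

end

theory Submission
  imports Defs
begin

text \<open>Write \<open>p\<^sub>i\<close> and \<open>r\<^sub>j\<close> for the projections of \<open>V\<close> and \<open>W\<close> to their stages. A neighbourhood of
  \<open>0\<close> in a finite-dimensional space on which no coordinate takes the value \<open>1\<close> contains no nonzero
  subspace, so by continuity \<open>r\<^sub>j \<circ> T\<close> vanishes on the kernel of some \<open>p\<^sub>i\<close>. Suppose that
  \<open>r\<^sub>j w \<in> r\<^sub>j (T V)\<close> for all \<open>j\<close>. The sets \<open>A\<^sub>j = {v. r\<^sub>j (T v) = r\<^sub>j w}\<close> are decreasing nonempty affine
  subspaces, and for each \<open>i\<close> the images \<open>p\<^sub>i A\<^sub>j\<close> become constant in \<open>j\<close> for reasons of dimension.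
  The eventual values form an inverse sequence with surjective maps, which has a compatible
  sequence; it is a \<open>v \<in> V\<close> with \<open>T v = w\<close>. Hence \<open>T V\<close> is the intersection of the preimages of the
  \<open>r\<^sub>j (T V)\<close>, which are closed because all subspaces of a finite-dimensional space are closed.\<close>

section \<open>Linear maps on subspaces\<close>

lemma linear_on_add: "linear_on s1 s2 S f \<Longrightarrow> x \<in> S \<Longrightarrow> y \<in> S \<Longrightarrow> f (x + y) = f x + f y"
  and linear_on_scale: "linear_on s1 s2 S f \<Longrightarrow> x \<in> S \<Longrightarrow> f (s1 c x) = s2 c (f x)"
  by (auto simp: linear_on_def)

lemma linear_on_zero:
  assumes "linear_on s1 s2 S f" "0 \<in> S"
  shows "f 0 = 0"
  using linear_on_add[OF assms(1,2,2)] by simp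

text \<open>Additivity applied to \<open>(x - y) + y\<close>; membership of the difference is a
  hypothesis because \<open>S\<close> is an arbitrary set here.\<close>

lemma linear_on_diff:
  assumes "linear_on s1 s2 S f" "x - y \<in> S" "y \<in> S"
  shows "f (x - y) = f x - f y"
  using linear_on_add[OF assms] by simp

lemma linear_on_compose:
  assumes "linear_on s1 s2 S f" "linear_on s2 s3 R g" "f \<in> S \<rightarrow> R"
  shows "linear_on s1 s3 S (\<lambda>x. g (f x))"
  using assms by (auto simp: linear_on_def Pi_iff)

lemma linear_on_subset: "linear_on s1 s2 S f \<Longrightarrow> R \<subseteq> S \<Longrightarrow> linear_on s1 s2 R f"
  unfolding linear_on_def by blast

text \<open>Membership and value are proved in one induction, since additivity at the next term
  requires the partial sum to lie in \<open>S\<close>.\<close>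

lemma linear_on_sum_scaled:
  fixes f :: "'a::ab_group_add \<Rightarrow> 'b::ab_group_add"
  assumes "vector_space s1" and S: "module.subspace s1 S" and f: "linear_on s1 s2 S f"
    and "finite I" "\<And>i. i \<in> I \<Longrightarrow> e i \<in> S"
  shows "(\<Sum>i\<in>I. s1 (c i) (e i)) \<in> S \<and> f (\<Sum>i\<in>I. s1 (c i) (e i)) = (\<Sum>i\<in>I. s2 (c i) (f (e i)))"
proof -
  interpret vector_space s1 by fact
  show ?thesis
    using assms(4,5)
  proof (induction I rule: finite_induct)
    case empty
    then show ?case using subspace_0[OF S] linear_on_zero[OF f] by simp
  next
    case (insert i I)
    then show ?case
      using subspace_add[OF S] subspace_scale[OF S] linear_on_add[OF f] linear_on_scale[OF f] by simp
  qed
qed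

lemma linear_on_image_subspace:
  assumes "vector_space s1" "vector_space s2" and S: "module.subspace s1 S"
    and f: "linear_on s1 s2 S f"
  shows "module.subspace s2 (f ` S)"
proof -
  interpret v1: vector_space s1 by fact
  interpret v2: vector_space s2 by fact
  show ?thesis
  proof (rule v2.subspaceI)
    show "0 \<in> f ` S"
      using linear_on_zero[OF f] v1.subspace_0[OF S] by (metis image_eqI)
    fix x y assume "x \<in> f ` S" "y \<in> f ` S"
    then show "x + y \<in> f ` S"
      using linear_on_add[OF f] v1.subspace_add[OF S] by (auto simp: image_iff) metis
  next
    fix c x assume "x \<in> f ` S"
    then show "s2 c x \<in> f ` S"
      using linear_on_scale[OF f] v1.subspace_scale[OF S] by (auto simp: image_iff) metis
  qed
qed

lemma linear_on_kernel_subspace: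
  assumes "vector_space s1" "vector_space s2" and S: "module.subspace s1 S"
    and f: "linear_on s1 s2 S f"
  shows "module.subspace s1 {x \<in> S. f x = 0}"
proof -
  interpret v1: vector_space s1 by fact
  interpret v2: vector_space s2 by fact
  show ?thesis
    using v1.subspace_0[OF S] v1.subspace_add[OF S] v1.subspace_scale[OF S]
    by (intro v1.subspaceI)
       (auto simp: linear_on_zero[OF f] linear_on_add[OF f] linear_on_scale[OF f])
qed

section \<open>Dimension and stabilization of decreasing chains\<close>

lemma (in vector_space) subspace_eq_of_dim_eq:
  assumes "subspace S" "subspace R" "S \<subseteq> R" "R \<subseteq> span B" "finite B" "dim S = dim R"
  shows "S = R"
proof -
  obtain C where C: "C \<subseteq> S" "independent C" "S \<subseteq> span C" "card C = dim S"
    using basis_exists by metis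
  obtain D where D: "C \<subseteq> D" "D \<subseteq> R" "independent D" "R \<subseteq> span D"
    using maximal_independent_subset_extend[of C R] C \<open>S \<subseteq> R\<close> by blast
  \<comment> \<open>An independent set in the span of the finite \<open>B\<close> is finite; only
    then does equality of cardinalities force the basis \<open>C\<close> of \<open>S\<close> to be
    all of the basis \<open>D\<close> of \<open>R\<close>.\<close>
  have "finite D"
    using independent_span_bound[of B D] D assms by auto
  moreover have "card D = dim R"
    using D dim_eq_card[of D R] assms(2) span_minimal[of D R] span_eq_iff by (metis antisym)
  ultimately have "C = D"
    using card_subset_eq[of D C] D C assms by simp
  then show ?thesis
    using C D assms span_minimal[of C S] by blast
qed

text \<open>Dimensions are natural numbers, so some \<open>S m\<close> has the least one. A later
  member lies in \<open>S m\<close> and cannot have smaller dimension, hence equals it.\<close>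

lemma (in vector_space) antimono_subspaces_stabilize:
  assumes sub: "\<And>j. subspace (S j)" and dec: "antimono (S :: nat \<Rightarrow> 'b set)"
    and "\<And>j. S j \<subseteq> span B" "finite B"
  shows "\<exists>m. \<forall>j\<ge>m. S j = S m"
proof -
  obtain m where m: "\<And>j. dim (S m) \<le> dim (S j)"
    using ex_has_least_nat[of "\<lambda>_. True" _ "\<lambda>j. dim (S j)"] by blast
  have "S j = S m" if "m \<le> j" for j
  proof (rule subspace_eq_of_dim_eq[OF sub sub _ assms(3,4)])
    show "S j \<subseteq> S m" using dec that by (auto dest: antimonoD)
    obtain C where C: "C \<subseteq> S m" "independent C" "S m \<subseteq> span C" "card C = dim (S m)"
      using basis_exists by metis
    obtain D where D: "D \<subseteq> S j" "independent D" "S j \<subseteq> span D" "card D = dim (S j)"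
      using basis_exists by metis
    have "finite C" using independent_span_bound[of B C] C assms by blast
    then have "card D \<le> card C"
      using independent_span_bound[of C D] C D \<open>S j \<subseteq> S m\<close> by blast
    then show "dim (S j) = dim (S m)" using C D m[of j] by simp
  qed
  then show ?thesis by blast
qed

text \<open>The nonempty fibre at \<open>j\<close> is a translate of the kernel \<open>K j\<close>.
  The images of the kernels are a decreasing chain of subspaces of a finite-dimensional space; their
  stabilization carries over to the fibres.\<close>

lemma affine_images_stabilize:
  assumes V: "vector_space s" and A: "vector_space sA" and B: "vector_space sB"
    and S: "module.subspace s S"
    and P: "linear_on s sA S P" "P ` S \<subseteq> module.span sA E" "finite E"
    and L: "\<And>j. linear_on s sB S (L j)"
    and ne: "\<And>j::nat. \<exists>v\<in>S. L j v = y j"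
    and dec: "antimono (\<lambda>j. {v \<in> S. L j v = y j})"
  shows "\<exists>m. \<forall>j\<ge>m. P ` {v \<in> S. L j v = y j} = P ` {v \<in> S. L m v = y m}"
proof -
  interpret v: vector_space s by fact
  interpret a: vector_space sA by fact
  define K where "K j = {v \<in> S. L j v = 0}" for j
  have K: "v.subspace (K j)" for j
    unfolding K_def by (rule linear_on_kernel_subspace[OF V B S L])
  have K_le: "K j \<subseteq> K i" if "i \<le> j" for i j
  proof
    fix u assume u: "u \<in> K j"
    obtain a where a: "a \<in> S" "L j a = y j" using ne by blast
    \<comment> \<open>Both points of the fibre at \<open>j\<close> lie in the fibre at
      \<open>i\<close>, so \<open>L i\<close> kills their difference \<open>u\<close>.\<close>
    have "a + u \<in> {v \<in> S. L j v = y j}" "a \<in> {v \<in> S. L j v = y j}"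
      using a u v.subspace_add[OF S] linear_on_add[OF L] by (auto simp: K_def)
    then have "L i (a + u) = y i" "L i a = y i"
      using antimonoD[OF dec that] by auto
    then show "u \<in> K i"
      using a u linear_on_add[OF L, of a u i] by (auto simp: K_def)
  qed
  have "\<exists>m. \<forall>j\<ge>m. P ` K j = P ` K m"
  proof (rule a.antimono_subspaces_stabilize)
    show "a.subspace (P ` K j)" for j
      using linear_on_image_subspace[OF V A K linear_on_subset[OF P(1)]] by (auto simp: K_def)
    show "antimono (\<lambda>j. P ` K j)" using K_le by (intro antimonoI image_mono)
    show "P ` K j \<subseteq> a.span E" for j using P by (auto simp: K_def)
  qed fact
  then obtain m where m: "\<And>j. m \<le> j \<Longrightarrow> P ` K j = P ` K m" by blast
  have "P ` {v \<in> S. L m v = y m} \<subseteq> P ` {v \<in> S. L j v = y j}" if "m \<le> j" for j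
  proof clarify
    fix v assume v: "v \<in> S" "L m v = y m"
    obtain a where a: "a \<in> S" "L j a = y j" using ne by blast
    then have "L m a = y m" using antimonoD[OF dec that] by auto
    moreover have d: "v - a \<in> S" using v a v.subspace_diff[OF S] by blast
    ultimately have "v - a \<in> K m"
      using linear_on_diff[OF L d a(1)] v by (auto simp: K_def)
    \<comment> \<open>Stability replaces \<open>v - a\<close>, which is only in \<open>K m\<close>,
      by some \<open>u\<close> in \<open>K j\<close> with the same image; then \<open>a + u\<close>
      is the point of the fibre at \<open>j\<close> with the image of \<open>v\<close>.\<close>
    then have "P (v - a) \<in> P ` K j" using m[OF that] by blast
    then obtain u where u: "u \<in> K j" "P (v - a) = P u" by blast
    then have "P v = P (a + u)"
      using linear_on_diff[OF P(1) d a(1)] linear_on_add[OF P(1), of a u] a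
      by (auto simp: K_def algebra_simps)
    moreover have "a + u \<in> S" "L j (a + u) = y j"
      using a u v.subspace_add[OF S] linear_on_add[OF L] by (auto simp: K_def)
    ultimately show "P v \<in> P ` {v \<in> S. L j v = y j}" by blast
  qed
  then show ?thesis using antimonoD[OF dec] by (meson antisym image_mono)
qed

section \<open>Topology of finite-dimensional spaces\<close>

lemma fd_space_subspace: "fd_space s X \<Longrightarrow> module.subspace s (topspace X)"
  by (metis fd_space_def module.subspace_span module_iff_vector_space)

lemma fd_space_coordinates:
  fixes s :: "'k::topological_field \<Rightarrow> 'a::ab_group_add \<Rightarrow> 'a"
  assumes "fd_space s X"
  obtains n and \<phi> :: "'a \<Rightarrow> nat \<Rightarrow> 'k"
  where "\<And>i. i < n \<Longrightarrow> linear_on s (*) (topspace X) (\<lambda>x. \<phi> x i)"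
    and "\<And>i. i < n \<Longrightarrow> continuous_map X euclidean (\<lambda>x. \<phi> x i)"
    and "bij_betw \<phi> (topspace X) (PiE {..<n} (\<lambda>_. UNIV))"
proof -
  define n where "n = vector_space.dim s (topspace X)"
  obtain \<phi> :: "'a \<Rightarrow> nat \<Rightarrow> 'k"
    where l: "\<forall>i<n. linear_on s (*) (topspace X) (\<lambda>x. \<phi> x i)"
    and h: "homeomorphic_map X (product_topology (\<lambda>_. euclidean) {..<n}) \<phi>"
    using assms unfolding fd_space_def n_def by blast
  have "continuous_map X (product_topology (\<lambda>_. euclidean) {..<n}) \<phi>"
    using h homeomorphic_imp_continuous_map by blast
  then have "continuous_map X euclidean (\<lambda>x. \<phi> x i)" if "i < n" for i
    using that by (auto simp: continuous_map_componentwise)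
  moreover have "bij_betw \<phi> (topspace X) (PiE {..<n} (\<lambda>_. UNIV))"
    using homeomorphic_imp_surjective_map[OF h] homeomorphic_imp_injective_map[OF h]
    by (simp add: bij_betw_def)
  ultimately show ?thesis using l that by blast
qed

text \<open>A linear functional is a combination of the continuous coordinates, with its values on
  the standard basis as coefficients.\<close>

lemma fd_space_linear_functional_continuous:
  fixes s :: "'k::topological_field \<Rightarrow> 'a::ab_group_add \<Rightarrow> 'a"
  assumes X: "fd_space s X" and f: "linear_on s (*) (topspace X) f"
  shows "continuous_map X euclidean f"
proof -
  have v: "vector_space s" using X by (simp add: fd_space_def)
  interpret vector_space s by fact
  note S = fd_space_subspace[OF X]
  obtain n and \<phi> :: "'a \<Rightarrow> nat \<Rightarrow> 'k"
    where lin: "\<And>i. i < n \<Longrightarrow> linear_on s (*) (topspace X) (\<lambda>x. \<phi> x i)"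
      and cont: "\<And>i. i < n \<Longrightarrow> continuous_map X euclidean (\<lambda>x. \<phi> x i)"
      and bij: "bij_betw \<phi> (topspace X) (PiE {..<n} (\<lambda>_. UNIV))"
    using fd_space_coordinates[OF X] by metis
  \<comment> \<open>Preimages of the unit vectors, restricted so as to be points of the extensional
    product. For \<open>i\<close> beyond \<open>n\<close> this is the zero vector, so
    \<open>e\<close> can be chosen as a total function.\<close>
  have "\<exists>e\<in>topspace X. \<phi> e = restrict (\<lambda>k. if k = i then 1 else 0) {..<n}" for i
  proof -
    have "restrict (\<lambda>k. if k = i then 1 else 0) {..<n} \<in> \<phi> ` topspace X"
      using bij by (auto simp: bij_betw_def)
    then show ?thesis by (metis imageE)
  qed
  then obtain e where e: "\<And>i. e i \<in> topspace X"
    "\<And>i. \<phi> (e i) = restrict (\<lambda>k. if k = i then 1 else 0) {..<n}"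
    by metis
  have "f x = (\<Sum>i<n. \<phi> x i * f (e i))" if x: "x \<in> topspace X" for x
  proof -
    let ?y = "\<Sum>i<n. s (\<phi> x i) (e i)"
    have y: "?y \<in> topspace X" "f ?y = (\<Sum>i<n. \<phi> x i * f (e i))"
      using linear_on_sum_scaled[OF v S f, of "{..<n}" e] e by auto
    have "\<phi> ?y k = \<phi> x k" if "k < n" for k
    proof -
      have "\<phi> ?y k = (\<Sum>i<n. \<phi> x i * \<phi> (e i) k)"
        using linear_on_sum_scaled[OF v S lin[OF that], of "{..<n}" e] e by auto
      also have "\<dots> = (\<Sum>i<n. if k = i then \<phi> x i else 0)"
        using that e by (intro sum.cong) auto
      also have "\<dots> = \<phi> x k" using that by simp
      finally show ?thesis .
    qed
    then have "\<phi> ?y = \<phi> x"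
      using bij_betwE[OF bij] x y by (intro PiE_ext[where k = "{..<n}" and s = "\<lambda>_. UNIV"]) auto
    then have "?y = x"
      using bij x y by (auto simp: bij_betw_def dest: inj_onD)
    then show ?thesis using y by simp
  qed
  moreover have "continuous_map X euclidean (\<lambda>x. \<Sum>i<n. \<phi> x i * f (e i))"
    using cont unfolding continuous_map_atin
    by (auto intro!: tendsto_sum tendsto_mult_right)
  ultimately show ?thesis
    using continuous_map_eq[of X euclidean "\<lambda>x. \<Sum>i<n. \<phi> x i * f (e i)" f] by simp
qed

text \<open>Each point outside \<open>R\<close> is separated from \<open>R\<close> by the closed
  kernel of a linear functional, and \<open>R\<close> is the intersection of these kernels.\<close>

lemma fd_space_closedin_subspace:
  fixes s :: "'k::topological_field \<Rightarrow> 'a::ab_group_add \<Rightarrow> 'a"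
  assumes X: "fd_space s X" and R: "module.subspace s R" "R \<subseteq> topspace X"
  shows "closedin X R"
proof -
  have v: "vector_space s" using X by (simp add: fd_space_def)
  interpret vector_space s by fact
  note S = fd_space_subspace[OF X]
  have "\<exists>C. closedin X C \<and> R \<subseteq> C \<and> x \<notin> C" if x: "x \<in> topspace X" "x \<notin> R" for x
  proof -
    obtain C where C: "C \<subseteq> R" "independent C" "R \<subseteq> span C"
      using maximal_independent_subset by blast
    have CR: "span C = R" using C R span_minimal by blast
    then have "independent (insert x C)"
      using C x by (auto simp: independent_insert)
    then obtain D where D: "insert x C \<subseteq> D" "D \<subseteq> topspace X" "independent D" "topspace X \<subseteq> span D"
      using maximal_independent_subset_extend[of "insert x C" "topspace X"] x R C by blast
    \<comment> \<open>The coordinate at the basis vector \<open>x\<close>: it is 1 at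
      \<open>x\<close>, and 0 on \<open>R\<close> because expansions there involve only
      \<open>C\<close>, which omits \<open>x\<close>.\<close>
    define f where "f v = representation D v x" for v
    have "linear_on s (*) (topspace X) f"
      using D by (auto simp: linear_on_def f_def representation_add representation_scale subset_iff)
    then have f: "continuous_map X euclidean f"
      by (rule fd_space_linear_functional_continuous[OF X])
    have "closedin X {v \<in> topspace X. f v \<in> {0}}"
      by (rule closedin_continuous_map_preimage[OF f]) auto
    moreover have "f v = 0" if "v \<in> R" for v
    proof -
      have "representation D v = representation C v"
        using D that CR by (intro representation_extend) auto
      moreover have "representation C v x = 0"
        using representation_ne_zero[of C v x] C x by blast
      ultimately show ?thesis by (simp add: f_def)
    qed
    moreover have "f x = 1"
      using D by (auto simp: f_def representation_basis)
    ultimately show ?thesis using R by (intro exI[of _ "{v \<in> topspace X. f v \<in> {0}}"]) auto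
  qed
  then obtain C where C: "\<And>x. x \<in> topspace X - R \<Longrightarrow> closedin X (C x) \<and> R \<subseteq> C x \<and> x \<notin> C x"
    by (metis DiffE)
  \<comment> \<open>Inserting \<open>topspace X\<close> keeps the family nonempty when
    \<open>R\<close> is the whole space.\<close>
  then have "R = \<Inter>(insert (topspace X) (C ` (topspace X - R)))" using R by blast
  moreover have "closedin X (\<Inter>(insert (topspace X) (C ` (topspace X - R))))"
    by (rule closedin_Inter) (use C in auto)
  ultimately show ?thesis by simp
qed

lemma fd_space_no_small_subspaces:
  fixes s :: "'k::topological_field \<Rightarrow> 'a::ab_group_add \<Rightarrow> 'a"
  assumes X: "fd_space s X"
  obtains U where "openin X U" "0 \<in> U" "\<And>R. module.subspace s R \<Longrightarrow> R \<subseteq> U \<Longrightarrow> R \<subseteq> {0}"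
proof -
  interpret vector_space s using X by (simp add: fd_space_def)
  note S = fd_space_subspace[OF X]
  obtain n and \<phi> :: "'a \<Rightarrow> nat \<Rightarrow> 'k"
    where lin: "\<And>i. i < n \<Longrightarrow> linear_on s (*) (topspace X) (\<lambda>x. \<phi> x i)"
      and cont: "\<And>i. i < n \<Longrightarrow> continuous_map X euclidean (\<lambda>x. \<phi> x i)"
      and bij: "bij_betw \<phi> (topspace X) (PiE {..<n} (\<lambda>_. UNIV))"
    using fd_space_coordinates[OF X] by metis
  \<comment> \<open>Omitting the value 1 gives an open set since points of a Hausdorff field are
    closed. The factor \<open>topspace X\<close> covers \<open>n = 0\<close>, where the indexed
    intersection is \<open>UNIV\<close>.\<close>
  define U where "U = topspace X \<inter> (\<Inter>i<n. {x \<in> topspace X. \<phi> x i \<in> - {1}})"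
  have "openin X {x \<in> topspace X. \<phi> x i \<in> - {1}}" if "i < n" for i
    by (rule openin_continuous_map_preimage[OF cont[OF that]]) auto
  then have "openin X U"
    unfolding U_def by (cases "n = 0") auto
  moreover have zero: "\<phi> 0 i = 0" if "i < n" for i
    using linear_on_zero[OF lin[OF that]] subspace_0[OF S] .
  then have "0 \<in> U" using subspace_0[OF S] by (auto simp: U_def)
  moreover have "R \<subseteq> {0}" if R: "subspace R" "R \<subseteq> U" for R
  proof
    fix x assume x: "x \<in> R"
    then have xX: "x \<in> topspace X" using R by (auto simp: U_def)
    have "\<phi> x i = 0" if i: "i < n" for i
    proof (rule ccontr)
      assume nz: "\<phi> x i \<noteq> 0"
      \<comment> \<open>A nonzero coordinate can be rescaled to the forbidden value 1 without
        leaving \<open>R\<close>.\<close>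
      have "s (inverse (\<phi> x i)) x \<in> U" using R x subspace_scale by blast
      then have "\<phi> (s (inverse (\<phi> x i)) x) i \<noteq> 1" using i by (auto simp: U_def)
      then show False using linear_on_scale[OF lin[OF i] xX] nz by simp
    qed
    then have "\<phi> x = \<phi> 0"
      using bij_betwE[OF bij] xX subspace_0[OF S] zero
      by (intro PiE_ext[where k = "{..<n}" and s = "\<lambda>_. UNIV"]) auto
    then show "x \<in> {0}"
      using bij xX subspace_0[OF S] by (auto simp: bij_betw_def dest: inj_onD)
  qed
  ultimately show ?thesis using that by blast
qed

section \<open>Inverse limits and their points\<close>

lemma topspace_inverse_limit:
  "topspace (inverse_limit F q) =
     {v. (\<forall>i. v i \<in> topspace (F i)) \<and> (\<forall>i. q i (v (Suc i)) = v i)}"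
  by (auto simp: inverse_limit_def PiE_iff)

text \<open>A basic open set of the product restricts only finitely many coordinates, and
  \<open>N\<close> bounds their indices.\<close>

lemma openin_inverse_limit_stage:
  assumes "openin (inverse_limit F q) G" "x \<in> G"
  shows "\<exists>N. \<forall>y \<in> topspace (inverse_limit F q). (\<forall>k\<le>N. y k = x k) \<longrightarrow> y \<in> G"
proof -
  obtain H where H: "openin (product_topology F UNIV) H"
    "G = H \<inter> {v. (\<forall>i. v i \<in> topspace (F i)) \<and> (\<forall>i. q i (v (Suc i)) = v i)}"
    using assms by (auto simp: inverse_limit_def openin_subtopology)
  then have "\<exists>U. finite {i \<in> UNIV. U i \<noteq> topspace (F i)} \<and> (\<forall>i\<in>UNIV. openin (F i) (U i)) \<and>
      x \<in> PiE UNIV U \<and> PiE UNIV U \<subseteq> H"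
    using assms(2) unfolding openin_product_topology_alt by blast
  then obtain U where U: "finite {i. U i \<noteq> topspace (F i)}" "x \<in> PiE UNIV U" "PiE UNIV U \<subseteq> H"
    by auto
  obtain N where N: "\<And>i. U i \<noteq> topspace (F i) \<Longrightarrow> i \<le> N"
    using U(1) by (auto simp: finite_nat_set_iff_bounded_le)
  have "y \<in> G" if y: "y \<in> topspace (inverse_limit F q)" "\<forall>k\<le>N. y k = x k" for y
  proof -
    have "y i \<in> U i" for i
      using N[of i] y U(2) by (cases "i \<le> N") (auto simp: topspace_inverse_limit PiE_iff)
    then have "y \<in> H" using U(3) by auto
    then show ?thesis using y(1) by (simp add: H(2) topspace_inverse_limit)
  qed
  then show ?thesis by blast
qed

text \<open>Fixes the data that \<open>pro_fd_space\<close> only asserts to exist, so that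
  \<open>V\<close> and \<open>W\<close> can each be equipped with a presentation.\<close>

locale pro_fd_presentation =
  fixes sA :: "'k::topological_field \<Rightarrow> 'a::ab_group_add \<Rightarrow> 'a"
    and s :: "'k \<Rightarrow> 'v::ab_group_add \<Rightarrow> 'v"
    and X :: "'v topology" and F :: "nat \<Rightarrow> 'a topology" and q and h :: "'v \<Rightarrow> nat \<Rightarrow> 'a"
  assumes tvs: "topological_vector_space s X"
    and seq: "fd_inverse_sequence sA F q"
    and lin: "linear_on s sA (topspace X) (\<lambda>x. h x i)"
    and homeo: "homeomorphic_map X (inverse_limit F q) h"
begin

lemma vector_space: "vector_space s" and subspace: "module.subspace s (topspace X)"
  using tvs by (auto simp: topological_vector_space_def)

lemma zero: "0 \<in> topspace X"
  using subspace vector_space module_iff_vector_space module.subspace_0 by metis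

lemma fd: "fd_space sA (F i)"
  using seq by (simp add: fd_inverse_sequence_def)

lemma stage_vector_space: "vector_space sA"
  using fd[of 0] by (simp add: fd_space_def)

lemma h_zero: "h 0 i = 0"
  by (rule linear_on_zero[OF lin zero])

lemma bij: "bij_betw h (topspace X)
    {v. (\<forall>i. v i \<in> topspace (F i)) \<and> (\<forall>i. q i (v (Suc i)) = v i)}"
  using homeomorphic_imp_surjective_map[OF homeo] homeomorphic_imp_injective_map[OF homeo]
  by (simp add: bij_betw_def topspace_inverse_limit)

lemma h_stage: "x \<in> topspace X \<Longrightarrow> h x i \<in> topspace (F i)"
  and h_compatible: "x \<in> topspace X \<Longrightarrow> q i (h x (Suc i)) = h x i"
  using bij_betwE[OF bij] by auto

lemma h_inject: "x \<in> topspace X \<Longrightarrow> y \<in> topspace X \<Longrightarrow> (\<And>i. h x i = h y i) \<Longrightarrow> x = y"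
  using inj_onD[OF bij_betw_imp_inj_on[OF bij]] by (metis ext)

lemma h_surject:
  assumes "\<And>i. v i \<in> topspace (F i)" "\<And>i. q i (v (Suc i)) = v i"
  obtains x where "x \<in> topspace X" "h x = v"
proof -
  have "v \<in> h ` topspace X" using assms bij by (auto simp: bij_betw_def)
  then show ?thesis using that by blast
qed

text \<open>Downward induction from \<open>j\<close>: the map \<open>q n\<close> determines
  coordinate \<open>n\<close> from coordinate \<open>Suc n\<close>.\<close>

lemma h_eq_le:
  assumes "x \<in> topspace X" "y \<in> topspace X" "h x j = h y j" "i \<le> j"
  shows "h x i = h y i"
  using assms(4)
proof (induction rule: inc_induct)
  case (step n)
  then show ?case using assms(1,2) h_compatible by metis
qed (rule assms(3))

lemma continuous_stage: "continuous_map X (F i) (\<lambda>x. h x i)"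
proof -
  have "continuous_map X (product_topology F UNIV) h"
    using homeomorphic_imp_continuous_map[OF homeo]
    by (simp add: inverse_limit_def continuous_map_in_subtopology)
  then show ?thesis by (simp add: continuous_map_componentwise_UNIV)
qed

text \<open>Vanishing at stage \<open>N\<close> forces vanishing at all earlier stages, so one
  coordinate controls the finitely many that a basic neighbourhood restricts.\<close>

lemma nhd_zero_contains_kernel:
  assumes "openin X U" "0 \<in> U"
  shows "\<exists>N. \<forall>x\<in>topspace X. h x N = 0 \<longrightarrow> x \<in> U"
proof -
  have U: "U \<subseteq> topspace X" using assms openin_subset by blast
  have "openin (inverse_limit F q) (h ` U)" 
    using homeomorphic_map_openness[OF homeo U] assms by blast
  from openin_inverse_limit_stage[OF this imageI[OF assms(2)]]
  obtain N where N: "\<And>y. y \<in> topspace (inverse_limit F q) \<Longrightarrow> \<forall>k\<le>N. y k = h 0 k \<Longrightarrow> y \<in> h ` U"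
    by blast
  have "x \<in> U" if x: "x \<in> topspace X" "h x N = 0" for x
  proof -
    have "h x \<in> h ` U"
    proof (rule N)
      show "h x \<in> topspace (inverse_limit F q)"
        using x homeomorphic_imp_surjective_map[OF homeo] by blast
      show "\<forall>k\<le>N. h x k = h 0 k"
        using h_eq_le[OF x(1) zero] x h_zero by simp
    qed
    then show ?thesis using x U bij by (auto simp: bij_betw_def dest: inj_onD)
  qed
  then show ?thesis by blast
qed

text \<open>For suitable \<open>N\<close>, \<open>L\<close> maps the kernel of the projection to
  stage \<open>N\<close> onto a subspace inside a neighbourhood that contains no nonzero
  subspace.\<close>

lemma continuous_linear_to_fd_vanishes_on_kernel:
  assumes Y: "fd_space sB Y" and L: "linear_on s sB (topspace X) L" "continuous_map X Y L"
  shows "\<exists>N. \<forall>x\<in>topspace X. h x N = 0 \<longrightarrow> L x = 0"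
proof -
  have B: "vector_space sB" using Y by (simp add: fd_space_def)
  obtain U where U: "openin Y U" "0 \<in> U" "\<And>R. module.subspace sB R \<Longrightarrow> R \<subseteq> U \<Longrightarrow> R \<subseteq> {0}"
    using fd_space_no_small_subspaces[OF Y] by metis
  have "openin X {x \<in> topspace X. L x \<in> U}" "0 \<in> {x \<in> topspace X. L x \<in> U}"
    using openin_continuous_map_preimage[OF L(2) U(1)] U(2) linear_on_zero[OF L(1) zero] zero
    by auto
  then obtain N where N: "\<And>x. x \<in> topspace X \<Longrightarrow> h x N = 0 \<Longrightarrow> L x \<in> U"
    using nhd_zero_contains_kernel by blast
  let ?K = "{x \<in> topspace X. h x N = 0}"
  have "module.subspace s ?K"
    by (rule linear_on_kernel_subspace[OF vector_space stage_vector_space subspace lin])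
  then have "module.subspace sB (L ` ?K)"
    by (rule linear_on_image_subspace[OF vector_space B]) (rule linear_on_subset[OF L(1)], blast)
  then have "L ` ?K \<subseteq> {0}" by (rule U(3)) (use N in auto)
  then show ?thesis by blast
qed

text \<open>A Mittag-Leffler argument: the eventual images \<open>C i\<close> are nonempty and the
  maps \<open>q i\<close> are surjective between them, so a compatible sequence can be chosen one
  stage at a time.\<close>

lemma inter_affine_nonempty:
  assumes Y: "\<And>j. fd_space sB (Y j)" and L: "\<And>j::nat. linear_on s sB (topspace X) (L j)"
    "\<And>j. continuous_map X (Y j) (L j)"
    and ne: "\<And>j. \<exists>v\<in>topspace X. L j v = y j"
    and dec: "antimono (\<lambda>j. {v \<in> topspace X. L j v = y j})"
  shows "\<exists>v\<in>topspace X. \<forall>j. L j v = y j"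
proof -
  have B: "vector_space sB" using Y[of 0] by (simp add: fd_space_def)
  define A where "A j = {v \<in> topspace X. L j v = y j}" for j
  have "\<exists>m. \<forall>j\<ge>m. (\<lambda>v. h v i) ` A j = (\<lambda>v. h v i) ` A m" for i
  proof -
    obtain E where E: "finite E" "module.span sA E = topspace (F i)"
      using fd[of i] by (auto simp: fd_space_def)
    show ?thesis
      unfolding A_def
      by (rule affine_images_stabilize[OF vector_space stage_vector_space B subspace lin _ E(1) L(1) ne dec])
         (use E h_stage in auto)
  qed
  then obtain m where m: "\<And>i j. m i \<le> j \<Longrightarrow> (\<lambda>v. h v i) ` A j = (\<lambda>v. h v i) ` A (m i)" by metis
  define C where "C i = (\<lambda>v. h v i) ` A (m i)" for i
  have "\<exists>b. \<forall>i. b i \<in> C i \<and> q i (b (Suc i)) = b i"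
  proof (rule dependent_nat_choice)
    show "\<exists>b. b \<in> C 0" using ne by (auto simp: C_def A_def)
    fix b i assume b: "b \<in> C i"
    \<comment> \<open>Past both stabilization indices, a single \<open>v\<close> in
      \<open>A ?M\<close> represents \<open>b\<close> at stage \<open>i\<close> and has its next
      coordinate in \<open>C (Suc i)\<close>.\<close>
    let ?M = "max (m i) (m (Suc i))"
    obtain v where v: "v \<in> A ?M" "b = h v i"
      using b m[of i ?M] by (auto simp: C_def)
    then have "h v (Suc i) \<in> C (Suc i)" using m[of "Suc i" ?M] by (auto simp: C_def)
    then show "\<exists>b'. b' \<in> C (Suc i) \<and> q i b' = b" using v h_compatible by (auto simp: A_def)
  qed
  then obtain b where b: "\<And>i. b i \<in> C i" "\<And>i. q i (b (Suc i)) = b i" by blast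
  have "b i \<in> topspace (F i)" for i
    using h_stage[of _ i] b(1)[of i] by (auto simp: C_def A_def)
  then obtain v where v: "v \<in> topspace X" "h v = b" using h_surject b(2) by metis
  have "L j v = y j" for j
  proof -
    \<comment> \<open>So far \<open>v\<close> only agrees with points of the \<open>A\<close> sets
      stage by stage. Since \<open>L j\<close> depends on coordinate \<open>N\<close> alone, one
      point of \<open>A j\<close> agreeing with \<open>v\<close> there suffices.\<close>
    obtain N where N: "\<And>x. x \<in> topspace X \<Longrightarrow> h x N = 0 \<Longrightarrow> L j x = 0"
      using continuous_linear_to_fd_vanishes_on_kernel[OF Y L] by blast
    \<comment> \<open>The maximum makes the index late enough for the image to be \<open>C N\<close>
      and for the set to lie in \<open>A j\<close>.\<close>
    have "C N = (\<lambda>v. h v N) ` A (max j (m N))" using m[of N "max j (m N)"] by (simp add: C_def)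
    also have "\<dots> \<subseteq> (\<lambda>v. h v N) ` A j" using antimonoD[OF dec, of j "max j (m N)"] by (auto simp: A_def)
    finally obtain a where a: "a \<in> A j" "b N = h a N" using b(1)[of N] by blast
    then have aX: "a \<in> topspace X" "L j a = y j" by (auto simp: A_def)
    have d: "v - a \<in> topspace X"
      using module.subspace_diff subspace v(1) aX(1) vector_space module_iff_vector_space by metis
    have "h (v - a) N = 0" using linear_on_diff[OF lin d aX(1), of N] a v by simp
    then show ?thesis using N[OF d] linear_on_diff[OF L(1) d aX(1)] aX by simp
  qed
  then show ?thesis using v by blast
qed

end

section \<open>Closedness of the image\<close>

lemma pro_fd_space_presentation:
  assumes "pro_fd_space sA s X"
  obtains F q h where "pro_fd_presentation sA s X F q h"
  using assms unfolding pro_fd_space_def pro_fd_presentation_def by metis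

theorem theorem3:
  fixes sA :: "'k::topological_field \<Rightarrow> 'a::ab_group_add \<Rightarrow> 'a"
    and sB :: "'k \<Rightarrow> 'b::ab_group_add \<Rightarrow> 'b"
    and sV :: "'k \<Rightarrow> 'v::ab_group_add \<Rightarrow> 'v"
    and sW :: "'k \<Rightarrow> 'w::ab_group_add \<Rightarrow> 'w"
    and V :: "'v topology" and W :: "'w topology"
    and T :: "'v \<Rightarrow> 'w"
  assumes "pro_fd_space sA sV V"
    and "pro_fd_space sB sW W"
    and "linear_on sV sW (topspace V) T"
    and "continuous_map V W T"
  shows "module.subspace sW (T ` topspace V) \<and> closedin W (T ` topspace V)"
proof -
  obtain F q h where "pro_fd_presentation sA sV V F q h"
    using pro_fd_space_presentation[OF assms(1)] .
  then interpret V: pro_fd_presentation sA sV V F q h .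
  obtain G r g where "pro_fd_presentation sB sW W G r g"
    using pro_fd_space_presentation[OF assms(2)] .
  then interpret W: pro_fd_presentation sB sW W G r g .
  have TW: "T \<in> topspace V \<rightarrow> topspace W" using continuous_map_funspace[OF assms(4)] .
  define L where "L j v = g (T v) j" for j v
  have Llin: "linear_on sV sB (topspace V) (L j)" for j
    unfolding L_def by (rule linear_on_compose[OF assms(3) W.lin TW])
  have Lcont: "continuous_map V (G j) (L j)" for j
    using continuous_map_compose[OF assms(4) W.continuous_stage[of j]] by (simp add: L_def[abs_def] o_def)
  let ?C = "\<lambda>j. {w \<in> topspace W. g w j \<in> L j ` topspace V}"
  have "w \<in> T ` topspace V" if w: "w \<in> topspace W" "\<And>j. g w j \<in> L j ` topspace V" for w
  proof -
    have "\<exists>v\<in>topspace V. \<forall>j. L j v = g w j"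
    proof (rule V.inter_affine_nonempty[OF W.fd Llin Lcont])
      show "\<exists>v\<in>topspace V. L j v = g w j" for j using w(2)[of j] by (metis imageE)
      show "antimono (\<lambda>j. {v \<in> topspace V. L j v = g w j})"
        \<comment> \<open>Agreement of \<open>T v\<close> and \<open>w\<close> at one stage of
          \<open>W\<close> passes down to all earlier stages, so the fibres decrease.\<close>
        using W.h_eq_le[OF _ w(1)] TW by (intro antimonoI) (auto simp: L_def Pi_iff)
    qed
    then obtain v where "v \<in> topspace V" "\<And>j. g (T v) j = g w j" by (auto simp: L_def)
    then show ?thesis using W.h_inject[OF _ w(1)] TW by (metis funcset_mem image_eqI)
  qed
  \<comment> \<open>The inclusion from right to left is the fact just shown; the other one holds by
    definition of \<open>L\<close>.\<close>
  then have "T ` topspace V = (\<Inter>j. ?C j)" using TW by (auto simp: L_def)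
  moreover have "closedin W (?C j)" for j
  proof (rule closedin_continuous_map_preimage[OF W.continuous_stage])
    show "closedin (G j) (L j ` topspace V)"
    proof (rule fd_space_closedin_subspace[OF W.fd])
      show "module.subspace sB (L j ` topspace V)"
        by (rule linear_on_image_subspace[OF V.vector_space W.stage_vector_space V.subspace Llin])
      show "L j ` topspace V \<subseteq> topspace (G j)"
        using TW W.h_stage by (auto simp: L_def)
    qed
  qed
  then have "closedin W (\<Inter>j. ?C j)" by (intro closedin_Inter) auto
  moreover have "module.subspace sW (T ` topspace V)"
    by (rule linear_on_image_subspace[OF V.vector_space W.vector_space V.subspace assms(3)])
  ultimately show ?thesis by simp
qed

end
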